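(* Let $3\le p<q$ be relatively prime integers and let $n\ge 3$. Let $\alpha_1,\dots,\alpha_{n-2}$ be integers of the same parity as $q$ with $q>\alpha_1>\alpha_2>\dots>\alpha_{n-2}\ge 0$, and let $\beta_1,\dots,\beta_{n-2}$ be integers of the same parity as $p$ with $0\le\beta_1<\beta_2<\dots<\beta_{n-2}<p$. Put $h_i=\frac{p\alpha_i+q\beta_i}{2}$ for $1\le i\le n-2$ and let $H=\langle p,q,h_1,\dots,h_{n-2}\rangle$. Let $T=T(\alpha,\beta)$ be the $n\times n$ matrix $$T=\begin{bmatrix} -\left(\frac{q+\alpha_{n-2}}{2}\right) & \frac{p-\beta_{n-2}}{2} & 0 & 0 & \cdots & 1\\ \frac{q-\alpha_1}{2} & -\left(\frac{p+\beta_1}{2}\right) & 1 & 0 & \cdots & 0\\ \alpha_1 & \beta_1 & -2 & 0 & \cdots & 0\\ \alpha_2 & \beta_2 & 0 & -2 & \cdots & 0\\ \vdots & \vdots & \vdots & \vdots & \ddots & \vdots\\ \alpha_{n-2} & \beta_{n-2} & 0 & 0 & \cdots & -2 \end{bmatrix},$$ that is: row 1 has entries $-\frac{q+\alpha_{n-2}}{2}$, $\frac{p-\beta_{n-2}}{2}$ in columns 1, 2, entry $1$ in column $n$, and zeros elsewhere; row 2 has entries $\frac{q-\alpha_1}{2}$, $-\frac{p+\beta_1}{2}$, $1$ in columns 1, 2, 3 and zeros elsewhere; and for $1\le i\le n-2$ row $i+2$ has entries $\alpha_i$, $\beta_i$ in columns 1, 2, entry $-2$ in column $i+2$, and zeros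 elsewhere. Consider the conditions: (i) $p$ and $q$ are both odd; (ii) $p$ is even and $2h_1\ne p\alpha_1$; (iii) $p$ is even, $2h_1=p\alpha_1$, but $q\le 2\alpha_1-\alpha_{n-2}$; (iv) $q$ is even and $2h_{n-2}\ne q\beta_{n-2}$; (v) $q$ is even and $p\le 2\beta_{n-2}-\beta_1$. (a) If at least one of (i)–(v) holds, then $T$ is a principal matrix for $H$ (with respect to the ordered generators $p,q,h_1,\dots,h_{n-2}$) if and only if $H\in KW(p,q)$. (b) Suppose none of (i)–(v) holds and that $\{p,q,h_1,\dots,h_{n-2}\}$ is the minimal generating set of $H$. If $p$ is even, then the matrix obtained from $T$ by replacing its first row by $(-\alpha_1,\,0,\,2,\,0,\dots,0)$ (entry $2$ in column $3$) is a principal matrix of $H$. If $q$ is even, then the matrix obtained from $T$ by replacing its second row by $(0,\,-\beta_{n-2},\,0,\dots,0,\,2)$ (entry $2$ in column $n$) is a principal matrix of $H$.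
   Context: $\mathbb N$ denotes the nonnegative integers, and $\langle a_1,\dots,a_n\rangle$ the submonoid of $\mathbb N$ generated by $a_1,\dots,a_n$. A numerical semigroup is such a submonoid with $\gcd(a_1,\dots,a_n)=1$. Principal matrix: let $\mathbf a=(a_1,\dots,a_n)$ be positive integers minimally generating a semigroup $\langle\mathbf a\rangle$. A principal matrix of $\langle \mathbf a\rangle$ is an $n\times n$ integer matrix $M$ with diagonal entries $-c_1,\dots,-c_n$ and nonnegative off-diagonal entries such that $M\mathbf a=0$ (with $\mathbf a$ regarded as a column vector) and, for each $i$, $c_i$ is the smallest positive integer such that $c_ia_i\in\langle a_j : j\neq i\rangle$. The diagonal is uniquely determined by $\mathbf a$, but the off-diagonal entries need not be. The class $KW(p,q)$: for coprime integers $3\le p<q$, $KW(p,q)$ is the set of all numerical semigroups $H$ with $\langle p,q\rangle\subseteq H\subseteq\langle p,q,r\rangle$, where $r=p/2$ if $p$ is even, $r=q/2$ if $q$ is even, and $r=(p+q)/2$ if $p$ and $q$ are both odd. *)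

theory Defs
  imports Jordan_Normal_Form.Matrix "HOL.GCD" "HOL.Hull"
begin

definition add_submonoid :: "nat set \<Rightarrow> bool" where
  "add_submonoid S \<longleftrightarrow> 0 \<in> S \<and> (\<forall>x\<in>S. \<forall>y\<in>S. x + y \<in> S)"

definition gen_monoid :: "nat set \<Rightarrow> nat set" where
  "gen_monoid A = add_submonoid hull A"

definition numerical_semigroup :: "nat set \<Rightarrow> bool" where
  "numerical_semigroup H \<longleftrightarrow> (\<exists>A. finite A \<and> Gcd A = 1 \<and> H = gen_monoid A)"

definition minimal_generating_set :: "nat set \<Rightarrow> nat set \<Rightarrow> bool" where
  "minimal_generating_set A H \<longleftrightarrow>
     gen_monoid A = H \<and> (\<forall>B. B \<subset> A \<longrightarrow> gen_monoid B \<noteq> H)"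

(* M is a principal matrix of the semigroup H with respect to the ordered tuple a of
   minimal generators; rows and columns are indexed from 0. Since a is required to be
   distinct, the set {a ! j | j < n, j \<noteq> i} is the set of the generators other than a ! i. *)
definition principal_matrix :: "nat set \<Rightarrow> nat list \<Rightarrow> int mat \<Rightarrow> bool" where
  "principal_matrix H a M \<longleftrightarrow>
     (let n = length a in
        distinct a \<and> (\<forall>x\<in>set a. 0 < x) \<and> minimal_generating_set (set a) H \<and>
        M \<in> carrier_mat n n \<and>
        (\<forall>i<n. \<forall>j<n. i \<noteq> j \<longrightarrow> 0 \<le> M $$ (i, j)) \<and>
        M *\<^sub>v vec_of_list (map int a) = 0\<^sub>v n \<and>
        (\<forall>i<n. \<exists>c. M $$ (i, i) = - int c \<and>
           0 < c \<and> c * a ! i \<in> gen_monoid {a ! j | j. j < n \<and> j \<noteq> i} \<and>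
           (\<forall>d. 0 < d \<and> d * a ! i \<in> gen_monoid {a ! j | j. j < n \<and> j \<noteq> i} \<longrightarrow> c \<le> d)))"

definition KW_gen :: "nat \<Rightarrow> nat \<Rightarrow> nat" where
  "KW_gen p q = (if even p then p div 2 else if even q then q div 2 else (p + q) div 2)"

definition KW :: "nat \<Rightarrow> nat \<Rightarrow> nat set set" where
  "KW p q = {H. numerical_semigroup H \<and>
     gen_monoid {p, q} \<subseteq> H \<and> H \<subseteq> gen_monoid {p, q, KW_gen p q}}"

(* The sequences alpha and beta are indexed from 1 to n - 2, other values being irrelevant.
   Under the parity hypotheses of the theorem all divisions by 2 below are exact. *)
definition h_gen :: "nat \<Rightarrow> nat \<Rightarrow> (nat \<Rightarrow> nat) \<Rightarrow> (nat \<Rightarrow> nat) \<Rightarrow> nat \<Rightarrow> nat" where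
  "h_gen p q \<alpha> \<beta> i = (p * \<alpha> i + q * \<beta> i) div 2"

definition gens :: "nat \<Rightarrow> nat \<Rightarrow> nat \<Rightarrow> (nat \<Rightarrow> nat) \<Rightarrow> (nat \<Rightarrow> nat) \<Rightarrow> nat list" where
  "gens p q n \<alpha> \<beta> = p # q # map (h_gen p q \<alpha> \<beta>) [1..<n - 1]"

(* Rows and columns are shifted by one: row i here is row i + 1 = (i - 1) + 2 of the usual
   1-based indexing, so for i \<ge> 2 it carries the entries alpha and beta of index i - 1. *)
definition T_mat :: "nat \<Rightarrow> nat \<Rightarrow> nat \<Rightarrow> (nat \<Rightarrow> nat) \<Rightarrow> (nat \<Rightarrow> nat) \<Rightarrow> int mat" where
  "T_mat p q n \<alpha> \<beta> = mat n n (\<lambda>(i, j).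
     if i = 0 then
       (if j = 0 then - ((int q + int (\<alpha> (n - 2))) div 2)
        else if j = 1 then (int p - int (\<beta> (n - 2))) div 2
        else if j = n - 1 then 1 else 0)
     else if i = 1 then
       (if j = 0 then (int q - int (\<alpha> 1)) div 2
        else if j = 1 then - ((int p + int (\<beta> 1)) div 2)
        else if j = 2 then 1 else 0)
     else
       (if j = 0 then int (\<alpha> (i - 1))
        else if j = 1 then int (\<beta> (i - 1))
        else if j = i then - 2 else 0))"

definition T_mat_p_even :: "nat \<Rightarrow> nat \<Rightarrow> nat \<Rightarrow> (nat \<Rightarrow> nat) \<Rightarrow> (nat \<Rightarrow> nat) \<Rightarrow> int mat" where
  "T_mat_p_even p q n \<alpha> \<beta> =
     change_row 0 (\<lambda>j _. if j = 0 then - int (\<alpha> 1) else if j = 2 then 2 else 0)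
       (T_mat p q n \<alpha> \<beta>)"

definition T_mat_q_even :: "nat \<Rightarrow> nat \<Rightarrow> nat \<Rightarrow> (nat \<Rightarrow> nat) \<Rightarrow> (nat \<Rightarrow> nat) \<Rightarrow> int mat" where
  "T_mat_q_even p q n \<alpha> \<beta> =
     change_row 1 (\<lambda>j _. if j = 1 then - int (\<beta> (n - 2)) else if j = n - 1 then 2 else 0)
       (T_mat p q n \<alpha> \<beta>)"

definition T_condition :: "nat \<Rightarrow> nat \<Rightarrow> nat \<Rightarrow> (nat \<Rightarrow> nat) \<Rightarrow> (nat \<Rightarrow> nat) \<Rightarrow> bool" where
  "T_condition p q n \<alpha> \<beta> \<longleftrightarrow>
     (odd p \<and> odd q) \<or>
     (even p \<and> 2 * h_gen p q \<alpha> \<beta> 1 \<noteq> p * \<alpha> 1) \<or>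
     (even p \<and> 2 * h_gen p q \<alpha> \<beta> 1 = p * \<alpha> 1 \<and>
        int q \<le> 2 * int (\<alpha> 1) - int (\<alpha> (n - 2))) \<or>
     (even q \<and> 2 * h_gen p q \<alpha> \<beta> (n - 2) \<noteq> q * \<beta> (n - 2)) \<or>
     (even q \<and> int p \<le> 2 * int (\<beta> (n - 2)) - int (\<beta> 1))"

end

theory Submission
  imports Defs
begin

text \<open>
  Write a number \<open>z\<close> in half-integral coordinates, \<open>2 * z = p * A + q * B\<close>. The generators
  \<open>p\<close>, \<open>q\<close>, \<open>h i\<close> have the coordinates \<open>(2, 0)\<close>, \<open>(0, 2)\<close>, \<open>(\<alpha> i, \<beta> i)\<close>, and since \<open>p\<close> and \<open>q\<close>
  are coprime the coordinates of a given number are unique up to adding multiples of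
  \<open>(q, - p)\<close>. Modulo 2 every \<open>(\<alpha> i, \<beta> i)\<close> equals \<open>(q, p)\<close>, which is not \<open>(0, 0)\<close>. A sum of
  generators therefore has coordinates of one of two kinds: both even, or congruent to
  \<open>(q, p)\<close>, and in the second case an odd number of the \<open>h j\<close> occurs, so that the coordinates
  dominate some \<open>(\<alpha> j, \<beta> j)\<close>. All minimality statements follow from this dichotomy.

  For \<open>h i\<close> the coordinates are forced to be \<open>(\<alpha> i, \<beta> i)\<close>, which dominates no other
  \<open>(\<alpha> j, \<beta> j)\<close> because \<open>\<alpha>\<close> decreases while \<open>\<beta>\<close> increases; so \<open>h i\<close> is not generated by the
  rest, whereas \<open>2 * h i = \<alpha> i * p + \<beta> i * q\<close> is (\<open>h_notin_gen\<close>). A multiple \<open>d * p\<close> has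
  coordinates \<open>(2 * d - k * q, k * p)\<close>. The case \<open>k = 1\<close> is of the second kind and gives
  \<open>q + \<alpha> j \<le> 2 * d\<close>, larger \<open>k\<close> give more, and \<open>k = 0\<close> is possible only with generators of second
  coordinate 0, that is, with an even number of copies of \<open>h 1\<close> when \<open>\<beta> 1 = 0\<close>
  (\<open>multiple_of_p_in_gen\<close>). So the least multiplier of \<open>p\<close> is the minimum of
  \<open>(q + \<alpha> (n - 2)) div 2\<close> and, if \<open>\<beta> 1 = 0\<close>, of \<open>\<alpha> 1\<close>. The statement for \<open>q\<close> is the same one
  with the roles of \<open>p\<close>, \<open>q\<close> and of \<open>\<alpha>\<close>, \<open>\<beta>\<close> exchanged.

  The five alternatives of \<open>T_condition\<close> say precisely that the first candidate is the minimum
  for both \<open>p\<close> and \<open>q\<close> (\<open>T_condition_iff\<close>), and then \<open>T\<close> is principal, all the least multipliers being at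
  least 2. If they fail, the second candidate is strictly smaller in one row, which is the one to
  be replaced; there minimality of the generators excludes the multiplier 1. The parities of the
  coordinates place \<open>H\<close> in \<open>KW p q\<close>, so in the first part both sides of the equivalence are true.
\<close>

section \<open>Generated submonoids\<close>

lemma add_submonoid_gen_monoid: "add_submonoid (gen_monoid A)"
  unfolding gen_monoid_def
  by (rule hull_in) (auto simp: add_submonoid_def)

lemma subset_gen_monoid: "A \<subseteq> gen_monoid A"
  unfolding gen_monoid_def by (rule hull_subset)

lemma gen_monoid_least:
  assumes "A \<subseteq> S" and "add_submonoid S"
  shows "gen_monoid A \<subseteq> S"
  unfolding gen_monoid_def using assms by (rule hull_minimal)

lemma gen_monoid_mono: "A \<subseteq> B \<Longrightarrow> gen_monoid A \<subseteq> gen_monoid B"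
  unfolding gen_monoid_def by (rule hull_mono)

lemma gen_monoid_base: "x \<in> A \<Longrightarrow> x \<in> gen_monoid A"
  using subset_gen_monoid by blast

lemma zero_in_gen_monoid: "0 \<in> gen_monoid A"
  using add_submonoid_gen_monoid unfolding add_submonoid_def by blast

lemma add_in_gen_monoid:
  "x \<in> gen_monoid A \<Longrightarrow> y \<in> gen_monoid A \<Longrightarrow> x + y \<in> gen_monoid A"
  using add_submonoid_gen_monoid unfolding add_submonoid_def by blast

lemma mult_in_gen_monoid:
  fixes c :: nat
  shows "x \<in> gen_monoid A \<Longrightarrow> c * x \<in> gen_monoid A"
  by (induction c) (auto simp: zero_in_gen_monoid add_in_gen_monoid)

lemma sum_in_gen_monoid:
  fixes f :: "'i \<Rightarrow> nat"
  assumes "\<And>j. j \<in> J \<Longrightarrow> f j \<in> gen_monoid A"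
  shows "sum f J \<in> gen_monoid A"
  using assms
  by (induction J rule: infinite_finite_induct) (auto simp: zero_in_gen_monoid add_in_gen_monoid)

lemma generator_not_redundant:
  assumes min: "minimal_generating_set A H" and "x \<in> A"
  shows "x \<notin> gen_monoid (A - {x})"
proof
  assume x: "x \<in> gen_monoid (A - {x})"
  have "A \<subseteq> gen_monoid (A - {x})"
    using x by (auto intro: gen_monoid_base)
  then have "gen_monoid A \<subseteq> gen_monoid (A - {x})"
    by (rule gen_monoid_least[OF _ add_submonoid_gen_monoid])
  moreover have "gen_monoid (A - {x}) \<subseteq> gen_monoid A"
    by (rule gen_monoid_mono) auto
  ultimately have "gen_monoid (A - {x}) = H"
    using min unfolding minimal_generating_set_def by auto
  then show False
    using min \<open>x \<in> A\<close> unfolding minimal_generating_set_def by blast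
qed

section \<open>Principal matrices row by row\<close>

definition principal_row :: "nat list \<Rightarrow> int mat \<Rightarrow> nat \<Rightarrow> bool" where
  "principal_row a M i \<longleftrightarrow>
     (\<forall>j<length a. i \<noteq> j \<longrightarrow> 0 \<le> M $$ (i, j)) \<and>
     (\<Sum>j<length a. M $$ (i, j) * int (a ! j)) = 0 \<and>
     (\<exists>c\<ge>2. M $$ (i, i) = - int c \<and>
        (\<forall>d>0. d * a ! i \<in> gen_monoid {a ! j | j. j < length a \<and> j \<noteq> i} \<longrightarrow> c \<le> d))"

text \<open>Asking for \<open>2 \<le> c\<close> folds minimality of the generators into the diagonal: taking
  \<open>d = 1\<close>, the generator \<open>a ! i\<close> is not generated by the others, so it is also nonzero and
  different from them. That \<open>c * a ! i\<close> is generated by the others is the relation expressed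
  by row \<open>i\<close>, with the diagonal term moved to the other side.\<close>

lemma principal_matrixI:
  assumes M: "M \<in> carrier_mat (length a) (length a)"
    and rows: "\<And>i. i < length a \<Longrightarrow> principal_row a M i"
  shows "principal_matrix (gen_monoid (set a)) a M"
proof -
  define n where "n = length a"
  define G where "G i = gen_monoid {a ! j | j. j < n \<and> j \<noteq> i}" for i
  have row: "\<forall>j<n. i \<noteq> j \<longrightarrow> 0 \<le> M $$ (i, j)" "(\<Sum>j<n. M $$ (i, j) * int (a ! j)) = 0"
    "\<exists>c\<ge>2. M $$ (i, i) = - int c \<and> (\<forall>d>0. d * a ! i \<in> G i \<longrightarrow> c \<le> d)" if "i < n" for i
    using rows[of i] that unfolding principal_row_def G_def n_def by simp_all
  have notin: "a ! i \<notin> G i" if i: "i < n" for i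
  proof
    assume "a ! i \<in> G i"
    moreover obtain c where "2 \<le> c" "\<forall>d>0. d * a ! i \<in> G i \<longrightarrow> c \<le> d"
      using row(3)[OF i] by blast
    ultimately have "c \<le> 1" by (auto dest: spec[of _ 1])
    with \<open>2 \<le> c\<close> show False by simp
  qed
  have dist: "distinct a"
    unfolding distinct_conv_nth
  proof (intro allI impI notI)
    fix i j assume *: "i < length a" "j < length a" "i \<noteq> j" "a ! i = a ! j"
    then have "a ! i \<in> G i"
      unfolding G_def by (intro gen_monoid_base CollectI exI[of _ j]) (auto simp: n_def)
    with notin[of i] * show False by (simp add: n_def)
  qed
  have pos: "0 < x" if "x \<in> set a" for x
  proof (rule gr0I)
    assume "x = 0"
    with that obtain i where "i < n" "a ! i = 0"
      unfolding n_def by (metis in_set_conv_nth)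
    with notin[of i] show False
      using zero_in_gen_monoid[of "{a ! j | j. j < n \<and> j \<noteq> i}"] by (simp add: G_def)
  qed
  have min: "gen_monoid B \<noteq> gen_monoid (set a)" if B: "B \<subset> set a" for B
  proof
    assume eq: "gen_monoid B = gen_monoid (set a)"
    obtain x where "x \<in> set a" "x \<notin> B" using B by blast
    then obtain i where i: "i < n" "a ! i \<notin> B"
      unfolding n_def by (metis in_set_conv_nth)
    have "B \<subseteq> {a ! j | j. j < n \<and> j \<noteq> i}"
    proof
      fix x assume x: "x \<in> B"
      then obtain j where "j < n" "x = a ! j"
        using B unfolding n_def by (metis in_set_conv_nth psubsetD)
      with x i show "x \<in> {a ! j | j. j < n \<and> j \<noteq> i}" by auto
    qed
    then have "gen_monoid B \<subseteq> G i"
      unfolding G_def by (rule gen_monoid_mono)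
    moreover have "a ! i \<in> gen_monoid (set a)"
      using i by (intro gen_monoid_base) (simp add: n_def)
    ultimately show False
      using eq notin i by blast
  qed
  have rel: "c * a ! i \<in> G i" if i: "i < n" and c: "M $$ (i, i) = - int c" for i c
  proof -
    have "int (c * a ! i) = (\<Sum>j\<in>{..<n} - {i}. M $$ (i, j) * int (a ! j))"
      using row(2)[OF i] i c by (subst (asm) sum.remove[of _ i]) auto
    also have "\<dots> = (\<Sum>j\<in>{..<n} - {i}. int (nat (M $$ (i, j)) * a ! j))"
      using row(1)[OF i] by (intro sum.cong) auto
    also have "\<dots> = int (\<Sum>j\<in>{..<n} - {i}. nat (M $$ (i, j)) * a ! j)"
      by simp
    finally have "c * a ! i = (\<Sum>j\<in>{..<n} - {i}. nat (M $$ (i, j)) * a ! j)"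
      by (simp only: of_nat_eq_iff)
    also have "\<dots> \<in> G i"
      unfolding G_def by (intro sum_in_gen_monoid mult_in_gen_monoid gen_monoid_base) auto
    finally show ?thesis .
  qed
  have ker: "M *\<^sub>v vec_of_list (map int a) = 0\<^sub>v n"
  proof (rule eq_vecI)
    fix i assume "i < dim_vec (0\<^sub>v n :: int vec)"
    then have i: "i < n" by simp
    have "(M *\<^sub>v vec_of_list (map int a)) $ i = (\<Sum>j<n. M $$ (i, j) * int (a ! j))"
      using M i
      by (simp add: scalar_prod_def n_def vec_of_list_index lessThan_atLeast0)
    then show "(M *\<^sub>v vec_of_list (map int a)) $ i = 0\<^sub>v n $ i"
      using row(2)[OF i] i by simp
  qed (use M in \<open>simp add: n_def\<close>)
  have diag: "\<exists>c. M $$ (i, i) = - int c \<and> 0 < c \<and> c * a ! i \<in> G i \<and>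
      (\<forall>d. 0 < d \<and> d * a ! i \<in> G i \<longrightarrow> c \<le> d)" if i: "i < n" for i
  proof -
    obtain c where "2 \<le> c" "M $$ (i, i) = - int c" "\<forall>d>0. d * a ! i \<in> G i \<longrightarrow> c \<le> d"
      using row(3)[OF i] by blast
    with rel[OF i] show ?thesis by (intro exI[of _ c]) auto
  qed
  have off: "\<forall>i<n. \<forall>j<n. i \<noteq> j \<longrightarrow> 0 \<le> M $$ (i, j)"
    using row(1) by blast
  show ?thesis
    unfolding principal_matrix_def Let_def minimal_generating_set_def n_def[symmetric]
  proof (intro conjI)
    show "\<forall>i<n. \<exists>c. M $$ (i, i) = - int c \<and> 0 < c \<and>
        c * a ! i \<in> gen_monoid {a ! j | j. j < n \<and> j \<noteq> i} \<and>
        (\<forall>d. 0 < d \<and> d * a ! i \<in> gen_monoid {a ! j | j. j < n \<and> j \<noteq> i} \<longrightarrow> c \<le> d)"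
      using diag unfolding G_def by (intro allI impI)
  qed (use dist pos min M ker off n_def in auto)
qed

lemma sum_three_support:
  fixes f :: "nat \<Rightarrow> int"
  assumes "2 \<le> k" and "k < n" and "\<And>j. j < n \<Longrightarrow> j \<noteq> 0 \<Longrightarrow> j \<noteq> 1 \<Longrightarrow> j \<noteq> k \<Longrightarrow> f j = 0"
  shows "(\<Sum>j<n. f j) = f 0 + f 1 + f k"
proof -
  have "(\<Sum>j<n. f j) = (\<Sum>j\<in>{0, 1, k}. f j)"
    using assms by (intro sum.mono_neutral_right) auto
  also have "\<dots> = f 0 + f 1 + f k"
    using assms by simp
  finally show ?thesis .
qed

section \<open>Half-integral coordinates\<close>

text \<open>Two pairs of coordinates of the same number differ by a multiple of \<open>(q, - p)\<close>. The box
  \<open>a < q\<close>, \<open>b < p\<close> is small enough that any such shift makes a coordinate negative.\<close>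

lemma coprime_coordinates_unique:
  fixes p q :: nat
  assumes "coprime p q" and eq: "p * A + q * B = p * a + q * b" and "a < q" and "b < p"
  shows "A = a \<and> B = b"
proof (cases "a \<le> A")
  case True
  then have "p * a \<le> p * A" by simp
  then have "q * B \<le> q * b" using eq by linarith
  then have "B \<le> b" using \<open>a < q\<close> by simp
  have "q * (b - B) = p * (A - a)"
    using eq True \<open>B \<le> b\<close> by (simp add: diff_mult_distrib2)
  then have "p dvd b - B"
    using \<open>coprime p q\<close> by (metis coprime_dvd_mult_right_iff dvd_triv_left)
  then have "b - B = 0"
    using \<open>b < p\<close> by (metis dvd_imp_le diff_le_self gr0I le_less_trans not_less)
  with \<open>B \<le> b\<close> have "B = b" by simp
  with eq \<open>b < p\<close> show ?thesis by simp
next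
  case False
  have "p * A \<le> p * a" using False by simp
  then have "q * (B - b) = p * (a - A)"
    using eq by (simp add: diff_mult_distrib2)
  then have "q dvd a - A"
    using \<open>coprime p q\<close> by (metis coprime_commute coprime_dvd_mult_right_iff dvd_triv_left)
  then show ?thesis
    using False \<open>a < q\<close> by (auto dest!: dvd_imp_le)
qed

text \<open>Coordinates can be chosen additively, so any additively closed property shared by
  coordinates of the generators passes to some coordinates of every element.\<close>

lemma gen_monoid_coordinates:
  fixes p q :: nat and P :: "nat \<Rightarrow> nat \<Rightarrow> bool"
  assumes "P 0 0"
    and add: "\<And>A B A' B'. P A B \<Longrightarrow> P A' B' \<Longrightarrow> P (A + A') (B + B')"
    and gen: "\<And>s. s \<in> S \<Longrightarrow> \<exists>A B. P A B \<and> 2 * s = p * A + q * B"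
    and "z \<in> gen_monoid S"
  shows "\<exists>A B. P A B \<and> 2 * z = p * A + q * B"
proof -
  have "add_submonoid {z. \<exists>A B. P A B \<and> 2 * z = p * A + q * B}"
    unfolding add_submonoid_def
  proof (intro conjI ballI)
    show "0 \<in> {z. \<exists>A B. P A B \<and> 2 * z = p * A + q * B}"
      using \<open>P 0 0\<close> by force
  next
    fix x y assume "x \<in> {z. \<exists>A B. P A B \<and> 2 * z = p * A + q * B}"
      and "y \<in> {z. \<exists>A B. P A B \<and> 2 * z = p * A + q * B}"
    then obtain A B A' B' where "P A B" "2 * x = p * A + q * B" "P A' B'" "2 * y = p * A' + q * B'"
      by blast
    then have "P (A + A') (B + B') \<and> 2 * (x + y) = p * (A + A') + q * (B + B')"
      by (auto simp: add algebra_simps)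
    then show "x + y \<in> {z. \<exists>A B. P A B \<and> 2 * z = p * A + q * B}" by blast
  qed
  with gen have "gen_monoid S \<subseteq> {z. \<exists>A B. P A B \<and> 2 * z = p * A + q * B}"
    by (intro gen_monoid_least) auto
  with \<open>z \<in> gen_monoid S\<close> show ?thesis by blast
qed

text \<open>The hypotheses are symmetric under exchanging \<open>p\<close> with \<open>q\<close> and \<open>\<alpha>\<close> with \<open>\<beta>\<close>, apart from
  the positivity of \<open>p\<close>; this is what lets the result on multiples of \<open>p\<close> serve for \<open>q\<close> as well.
  The index set is unordered because the exchange reverses monotonicity.\<close>

locale half_coordinates =
  fixes p q :: nat and I :: "'i set" and \<alpha> \<beta> h :: "'i \<Rightarrow> nat"
  assumes coprime_pq: "coprime p q" and p_pos: "0 < p"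
    and nonempty: "I \<noteq> {}"
    and parity_\<alpha>: "\<And>j. j \<in> I \<Longrightarrow> even (\<alpha> j) \<longleftrightarrow> even q"
    and parity_\<beta>: "\<And>j. j \<in> I \<Longrightarrow> even (\<beta> j) \<longleftrightarrow> even p"
    and \<alpha>_less: "\<And>j. j \<in> I \<Longrightarrow> \<alpha> j < q"
    and \<beta>_less: "\<And>j. j \<in> I \<Longrightarrow> \<beta> j < p"
    and double_h: "\<And>j. j \<in> I \<Longrightarrow> 2 * h j = p * \<alpha> j + q * \<beta> j"
begin

lemma not_both_even: "odd p \<or> odd q"
  using coprime_pq by (auto simp: coprime_def)

text \<open>The coordinates of \<open>h i\<close> are odd in the sense of the dichotomy, so a representation of
  \<open>h i\<close> uses some \<open>h j\<close>, whose coordinates would then be dominated by those of \<open>h i\<close>.\<close>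

lemma h_notin_gen:
  assumes "i \<in> I" and "J \<subseteq> I" and anti: "\<And>j. j \<in> J \<Longrightarrow> \<not> (\<alpha> j \<le> \<alpha> i \<and> \<beta> j \<le> \<beta> i)"
  shows "h i \<notin> gen_monoid ({p, q} \<union> h ` J)"
proof
  assume h: "h i \<in> gen_monoid ({p, q} \<union> h ` J)"
  define P where "P A B \<longleftrightarrow> even A \<and> even B \<or>
    (even A \<longleftrightarrow> even q) \<and> (even B \<longleftrightarrow> even p) \<and> (\<exists>j\<in>J. \<alpha> j \<le> A \<and> \<beta> j \<le> B)" for A B
  have "\<exists>A B. P A B \<and> 2 * h i = p * A + q * B"
  proof (rule gen_monoid_coordinates[OF _ _ _ h])
    show "P 0 0" by (simp add: P_def)
    show "P (A + A') (B + B')" if "P A B" "P A' B'" for A B A' B'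
    proof -
      have mono: "\<exists>j\<in>J. \<alpha> j \<le> A + A' \<and> \<beta> j \<le> B + B'"
        if "(\<exists>j\<in>J. \<alpha> j \<le> A \<and> \<beta> j \<le> B) \<or> (\<exists>j\<in>J. \<alpha> j \<le> A' \<and> \<beta> j \<le> B')"
        using that by (meson trans_le_add1 trans_le_add2)
      from that show ?thesis
        unfolding P_def even_add using mono by blast
    qed
    show "\<exists>A B. P A B \<and> 2 * s = p * A + q * B" if s: "s \<in> {p, q} \<union> h ` J" for s
    proof -
      consider "s = p" | "s = q" | j where "j \<in> J" "s = h j" using s by blast
      then show ?thesis
      proof cases
        case 1 then show ?thesis by (intro exI[of _ 2] exI[of _ 0]) (simp add: P_def)
      next
        case 2 then show ?thesis by (intro exI[of _ 0] exI[of _ 2]) (simp add: P_def)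
      next
        case 3
        with \<open>J \<subseteq> I\<close> have "j \<in> I" by blast
        then have "P (\<alpha> j) (\<beta> j)"
          unfolding P_def using 3(1) parity_\<alpha> parity_\<beta> by blast
        with double_h[OF \<open>j \<in> I\<close>] 3(2) show ?thesis by blast
      qed
    qed
  qed
  then obtain A B where P: "P A B" and "2 * h i = p * A + q * B" by blast
  then have "p * A + q * B = p * \<alpha> i + q * \<beta> i"
    using double_h[OF \<open>i \<in> I\<close>] by simp
  then have "A = \<alpha> i \<and> B = \<beta> i"
    using coprime_coordinates_unique[OF coprime_pq] \<alpha>_less \<beta>_less \<open>i \<in> I\<close> by blast
  with P have "P (\<alpha> i) (\<beta> i)" by simp
  then show False
    unfolding P_def using anti parity_\<alpha> parity_\<beta> \<open>i \<in> I\<close> not_both_even by blast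
qed

text \<open>The coordinates \<open>(2 * d - k * q, k * p)\<close> of \<open>d * p\<close> are treated according to \<open>k\<close>. The
  alternative \<open>\<alpha> j \<le> d\<close> is the case \<open>k = 0\<close>, where at least two generators with \<open>\<beta> j = 0\<close> are used.\<close>

lemma multiple_of_p_in_gen:
  assumes "0 < d" and d: "d * p \<in> gen_monoid ({q} \<union> h ` I)"
  shows "\<exists>j\<in>I. q + \<alpha> j \<le> 2 * d \<or> \<beta> j = 0 \<and> \<alpha> j \<le> d"
proof -
  \<comment> \<open>The dichotomy is refined in the even case: without \<open>q\<close> contributing, \<open>B = 0\<close> leaves only
    generators with \<open>\<beta> j = 0\<close>, an even number of them.\<close>
  define P where "P A B \<longleftrightarrow>
    even A \<and> even B \<and> (B = 0 \<longrightarrow> A = 0 \<or> (\<exists>j\<in>I. \<beta> j = 0 \<and> 2 * \<alpha> j \<le> A)) \<or>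
    (even A \<longleftrightarrow> even q) \<and> (even B \<longleftrightarrow> even p) \<and> (\<exists>j\<in>I. \<alpha> j \<le> A \<and> \<beta> j \<le> B)" for A B
  have "\<exists>A B. P A B \<and> 2 * (d * p) = p * A + q * B"
  proof (rule gen_monoid_coordinates[OF _ _ _ d])
    show "P 0 0" by (simp add: P_def)
    show "P (A + A') (B + B')" if P: "P A B" "P A' B'" for A B A' B'
    proof -
      \<comment> \<open>Two odd summands with total second coordinate 0: of the two indices the one with the
        smaller \<open>\<alpha>\<close> is the witness.\<close>
      have two: "\<exists>j\<in>I. \<beta> j = 0 \<and> 2 * \<alpha> j \<le> A + A'"
        if "j \<in> I" "\<alpha> j \<le> A" "\<beta> j \<le> B" "k \<in> I" "\<alpha> k \<le> A'" "\<beta> k \<le> B'" "B + B' = 0" for j k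
        by (rule bexI[of _ "if \<alpha> j \<le> \<alpha> k then j else k"]) (use that in auto)
      have mono: "\<exists>j\<in>I. \<alpha> j \<le> A + A' \<and> \<beta> j \<le> B + B'"
        if "(\<exists>j\<in>I. \<alpha> j \<le> A \<and> \<beta> j \<le> B) \<or> (\<exists>j\<in>I. \<alpha> j \<le> A' \<and> \<beta> j \<le> B')"
        using that by (meson trans_le_add1 trans_le_add2)
      have mono2: "\<exists>j\<in>I. \<beta> j = 0 \<and> 2 * \<alpha> j \<le> A + A'"
        if "(\<exists>j\<in>I. \<beta> j = 0 \<and> 2 * \<alpha> j \<le> A) \<or> (\<exists>j\<in>I. \<beta> j = 0 \<and> 2 * \<alpha> j \<le> A')"
        using that by (meson trans_le_add1 trans_le_add2)
      from P show ?thesis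
        unfolding P_def
      proof (elim disjE, goal_cases)
        case 1
        with mono2 show ?case by (intro disjI1) auto
      next
        case 2
        with mono show ?case by (intro disjI2) auto
      next
        case 3
        with mono show ?case by (intro disjI2) auto
      next
        case 4
        with two show ?case by (intro disjI1) auto
      qed
    qed
    show "\<exists>A B. P A B \<and> 2 * s = p * A + q * B" if s: "s \<in> {q} \<union> h ` I" for s
    proof -
      consider "s = q" | j where "j \<in> I" "s = h j" using s by blast
      then show ?thesis
      proof cases
        case 1 then show ?thesis by (intro exI[of _ 0] exI[of _ 2]) (simp add: P_def)
      next
        case 2
        then have "P (\<alpha> j) (\<beta> j)"
          unfolding P_def using parity_\<alpha> parity_\<beta> by blast
        with double_h[OF 2(1)] 2(2) show ?thesis by blast
      qed
    qed
  qed
  then obtain A B where P: "P A B" and eq: "2 * (d * p) = p * A + q * B" by blast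
  have "p dvd p * A + q * B" using eq by (metis dvd_triv_right dvd_mult)
  then have "p dvd q * B" by (simp add: dvd_add_right_iff)
  then have "p dvd B" using coprime_pq by (simp add: coprime_dvd_mult_right_iff)
  then obtain k where k: "B = p * k" by blast
  have "p * (2 * d) = p * (A + q * k)" using eq k by (simp add: algebra_simps)
  then have 2: "2 * d = A + q * k" using p_pos by simp
  \<comment> \<open>For \<open>k = 1\<close> the coordinates are \<open>(2 * d - q, p)\<close>, congruent to \<open>(q, p)\<close> modulo 2 and hence
    not both even.\<close>
  consider "k = 0" | "k = 1" | "2 \<le> k" by linarith
  then show ?thesis
  proof cases
    case 1
    then have "A = 2 * d" "B = 0" using 2 k by auto
    with P \<open>0 < d\<close> not_both_even show ?thesis unfolding P_def by auto
  next
    case k1: 2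
    then have A: "A + q = 2 * d" and "B = p" using 2 k by auto
    then have "even A \<longleftrightarrow> even q" by (metis even_add dvd_triv_left)
    with P \<open>B = p\<close> not_both_even obtain j where "j \<in> I" "\<alpha> j \<le> A"
      unfolding P_def by blast
    with A show ?thesis by force
  next
    case 3
    obtain j where j: "j \<in> I" using nonempty by blast
    have "q * 2 \<le> q * k" using 3 by simp
    then have "q + \<alpha> j \<le> 2 * d" using 2 \<alpha>_less[OF j] by linarith
    with j show ?thesis by blast
  qed
qed

end

section \<open>The generators and the rows of the matrix\<close>

locale kw_sequences =
  fixes p q n :: nat and \<alpha> \<beta> :: "nat \<Rightarrow> nat"
  assumes p_ge: "3 \<le> p" and p_less_q: "p < q" and cop: "coprime p q" and n_ge: "3 \<le> n"
    and par_\<alpha>: "\<forall>i\<in>{1..n - 2}. even (\<alpha> i) \<longleftrightarrow> even q"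
    and \<alpha>_first: "\<alpha> 1 < q" and \<alpha>_step: "\<forall>i\<in>{1..<n - 2}. \<alpha> (i + 1) < \<alpha> i"
    and par_\<beta>: "\<forall>i\<in>{1..n - 2}. even (\<beta> i) \<longleftrightarrow> even p"
    and \<beta>_step: "\<forall>i\<in>{1..<n - 2}. \<beta> i < \<beta> (i + 1)" and \<beta>_last: "\<beta> (n - 2) < p"
begin

abbreviation "I \<equiv> {1..n - 2}"
abbreviation "h \<equiv> h_gen p q \<alpha> \<beta>"
abbreviation "a \<equiv> gens p q n \<alpha> \<beta>"
abbreviation "T \<equiv> T_mat p q n \<alpha> \<beta>"

lemma odd_pq: "odd p \<or> odd q"
  using cop by (auto simp: coprime_def)

lemma \<alpha>_anti: "1 \<le> i \<Longrightarrow> i < j \<Longrightarrow> j \<le> n - 2 \<Longrightarrow> \<alpha> j < \<alpha> i"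
proof (induction j rule: nat_less_induct)
  case (1 j)
  then obtain m where m: "j = Suc m" by (cases j) auto
  with 1 have "\<alpha> j < \<alpha> m" using \<alpha>_step by auto
  with 1 m show ?case by (cases "m = i") (auto dest: spec[of _ m])
qed

lemma \<beta>_mono: "1 \<le> i \<Longrightarrow> i < j \<Longrightarrow> j \<le> n - 2 \<Longrightarrow> \<beta> i < \<beta> j"
proof (induction j rule: nat_less_induct)
  case (1 j)
  then obtain m where m: "j = Suc m" by (cases j) auto
  with 1 have "\<beta> m < \<beta> j" using \<beta>_step by auto
  with 1 m show ?case by (cases "m = i") (auto dest: spec[of _ m])
qed

lemma endpoints: "1 \<in> I" "n - 2 \<in> I"
  using n_ge by auto

lemma \<alpha>_bounds: "i \<in> I \<Longrightarrow> \<alpha> (n - 2) \<le> \<alpha> i \<and> \<alpha> i \<le> \<alpha> 1"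
  using \<alpha>_anti[of 1 i] \<alpha>_anti[of i "n - 2"] by (cases "i = 1"; cases "i = n - 2") auto

lemma \<beta>_bounds: "i \<in> I \<Longrightarrow> \<beta> 1 \<le> \<beta> i \<and> \<beta> i \<le> \<beta> (n - 2)"
  using \<beta>_mono[of 1 i] \<beta>_mono[of i "n - 2"] by (cases "i = 1"; cases "i = n - 2") auto

lemma double_h_gen:
  assumes "i \<in> I" shows "2 * h i = p * \<alpha> i + q * \<beta> i"
proof -
  have "even (p * \<alpha> i + q * \<beta> i)" using assms par_\<alpha> par_\<beta> by auto
  then show ?thesis unfolding h_gen_def by (rule dvd_mult_div_cancel)
qed

sublocale hc: half_coordinates p q I \<alpha> \<beta> h
proof
  show "\<alpha> j < q" if "j \<in> I" for j
    using \<alpha>_bounds[OF that] \<alpha>_first by linarith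
  show "\<beta> j < p" if "j \<in> I" for j
    using \<beta>_bounds[OF that] \<beta>_last by linarith
qed (use cop p_ge endpoints par_\<alpha> par_\<beta> double_h_gen in auto)

text \<open>The same configuration with the two coordinates exchanged.\<close>

sublocale swapped: half_coordinates q p I \<beta> \<alpha> h
  using hc.parity_\<alpha> hc.parity_\<beta> hc.\<alpha>_less hc.\<beta>_less hc.nonempty hc.double_h cop p_ge p_less_q
  by unfold_locales (auto simp: coprime_commute add.commute)

lemma \<beta>_zero: "j \<in> I \<Longrightarrow> \<beta> j = 0 \<Longrightarrow> j = 1"
  using \<beta>_mono[of 1 j] by force

lemma \<alpha>_zero: "j \<in> I \<Longrightarrow> \<alpha> j = 0 \<Longrightarrow> j = n - 2"
  using \<alpha>_anti[of j "n - 2"] by force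

text \<open>Parity makes the five alternatives collapse: \<open>\<beta> 1 = 0\<close> forces \<open>p\<close> to be even and
  \<open>\<alpha> (n - 2) = 0\<close> forces \<open>q\<close> to be even, so at most one of the two implications has a true
  premise. Each implication compares the two candidates for a least multiplier.\<close>

lemma T_condition_iff:
  "T_condition p q n \<alpha> \<beta> \<longleftrightarrow>
    (\<beta> 1 = 0 \<longrightarrow> q + \<alpha> (n - 2) \<le> 2 * \<alpha> 1) \<and> (\<alpha> (n - 2) = 0 \<longrightarrow> p + \<beta> 1 \<le> 2 * \<beta> (n - 2))"
proof -
  have h: "2 * h 1 = p * \<alpha> 1 \<longleftrightarrow> \<beta> 1 = 0" "2 * h (n - 2) = q * \<beta> (n - 2) \<longleftrightarrow> \<alpha> (n - 2) = 0"
    using double_h_gen endpoints p_ge p_less_q by auto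
  have b: "\<beta> 1 = 0 \<Longrightarrow> even p" "\<alpha> (n - 2) = 0 \<Longrightarrow> even q"
    using hc.parity_\<alpha>[OF endpoints(2)] hc.parity_\<beta>[OF endpoints(1)] by auto
  show ?thesis
    unfolding T_condition_def h using b odd_pq by linarith
qed

lemma length_a: "length a = n"
  using n_ge by (simp add: gens_def)

lemma a_0: "a ! 0 = p" and a_1: "a ! 1 = q"
  by (simp_all add: gens_def)

lemma a_h: "2 \<le> i \<Longrightarrow> i < n \<Longrightarrow> a ! i = h (i - 1)"
  by (auto simp: gens_def nth_Cons split: nat.splits)

lemma set_a: "set a = {p, q} \<union> h ` I"
  using n_ge by (auto simp: gens_def)

lemma others_subset:
  "{a ! j | j. j < n \<and> j \<noteq> 0} \<subseteq> {q} \<union> h ` I"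
  "{a ! j | j. j < n \<and> j \<noteq> 1} \<subseteq> {p} \<union> h ` I"
  "2 \<le> i \<Longrightarrow> i < n \<Longrightarrow> {a ! j | j. j < n \<and> j \<noteq> i} \<subseteq> {p, q} \<union> h ` (I - {i - 1})"
proof -
  have *: "j = 0 \<and> a ! j = p \<or> j = 1 \<and> a ! j = q \<or> 2 \<le> j \<and> j - 1 \<in> I \<and> a ! j = h (j - 1)"
    if "j < n" for j
  proof -
    consider "j = 0" | "j = 1" | "2 \<le> j" by linarith
    then show ?thesis by cases (use that a_h a_0 a_1 in auto)
  qed
  show "{a ! j | j. j < n \<and> j \<noteq> 0} \<subseteq> {q} \<union> h ` I"
    using * by blast
  show "{a ! j | j. j < n \<and> j \<noteq> 1} \<subseteq> {p} \<union> h ` I"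
    using * by blast
  show "{a ! j | j. j < n \<and> j \<noteq> i} \<subseteq> {p, q} \<union> h ` (I - {i - 1})" if "2 \<le> i" "i < n"
  proof (intro subsetI, elim CollectE exE conjE)
    fix x j assume j: "x = a ! j" "j < n" "j \<noteq> i"
    have "2 \<le> j \<Longrightarrow> j - 1 \<noteq> i - 1" using j that by linarith
    with *[OF j(2)] j show "x \<in> {p, q} \<union> h ` (I - {i - 1})" by auto
  qed
qed

lemma multiple_of_p:
  assumes "0 < d" and "d * a ! 0 \<in> gen_monoid {a ! j | j. j < n \<and> j \<noteq> 0}"
  shows "q + \<alpha> (n - 2) \<le> 2 * d \<or> \<beta> 1 = 0 \<and> \<alpha> 1 \<le> d"
proof -
  have "d * p \<in> gen_monoid ({q} \<union> h ` I)"
    using assms(2) gen_monoid_mono[OF others_subset(1)] a_0 by auto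
  from hc.multiple_of_p_in_gen[OF assms(1) this]
  obtain j where "j \<in> I" "q + \<alpha> j \<le> 2 * d \<or> \<beta> j = 0 \<and> \<alpha> j \<le> d" by blast
  then show ?thesis using \<alpha>_bounds \<beta>_zero by fastforce
qed

lemma multiple_of_q:
  assumes "0 < d" and "d * a ! 1 \<in> gen_monoid {a ! j | j. j < n \<and> j \<noteq> 1}"
  shows "p + \<beta> 1 \<le> 2 * d \<or> \<alpha> (n - 2) = 0 \<and> \<beta> (n - 2) \<le> d"
proof -
  have "d * q \<in> gen_monoid ({p} \<union> h ` I)"
    using assms(2) gen_monoid_mono[OF others_subset(2)] a_1 by auto
  from swapped.multiple_of_p_in_gen[OF assms(1) this]
  obtain j where "j \<in> I" "p + \<beta> j \<le> 2 * d \<or> \<alpha> j = 0 \<and> \<beta> j \<le> d" by blast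
  then show ?thesis using \<beta>_bounds \<alpha>_zero by fastforce
qed

lemma multiple_of_h:
  assumes i: "2 \<le> i" "i < n" and "0 < d" and d: "d * a ! i \<in> gen_monoid {a ! j | j. j < n \<and> j \<noteq> i}"
  shows "2 \<le> d"
proof (rule ccontr)
  assume "\<not> 2 \<le> d"
  with \<open>0 < d\<close> have "d = 1" by simp
  then have "h (i - 1) \<in> gen_monoid ({p, q} \<union> h ` (I - {i - 1}))"
    using d gen_monoid_mono[OF others_subset(3)[OF i]] a_h[OF i] by auto
  moreover have "h (i - 1) \<notin> gen_monoid ({p, q} \<union> h ` (I - {i - 1}))"
  proof (rule hc.h_notin_gen)
    show "i - 1 \<in> I" using i by auto
    show "\<not> (\<alpha> j \<le> \<alpha> (i - 1) \<and> \<beta> j \<le> \<beta> (i - 1))" if "j \<in> I - {i - 1}" for j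
    proof -
      have b: "1 \<le> j" "j \<le> n - 2" "j \<noteq> i - 1" "1 \<le> i - 1" "i - 1 \<le> n - 2"
        using that i by auto
      then consider "j < i - 1" | "i - 1 < j" by linarith
      then show ?thesis
      proof cases
        case 1
        with \<alpha>_anti[of j "i - 1"] b show ?thesis by simp
      next
        case 2
        with \<beta>_mono[of "i - 1" j] b show ?thesis by simp
      qed
    qed
  qed auto
  ultimately show False by simp
qed

text \<open>All rows in question are supported on the columns of \<open>p\<close>, \<open>q\<close> and a single \<open>h (k - 1)\<close>. The
  relation is stated doubled, which replaces \<open>h (k - 1)\<close> by its coordinates and avoids the
  divisions by 2.\<close>

lemma principal_rowI:
  assumes k: "2 \<le> k" "k < n"
    and off: "\<And>j. j < n \<Longrightarrow> i \<noteq> j \<Longrightarrow> 0 \<le> M $$ (i, j)"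
    and supp: "\<And>j. j < n \<Longrightarrow> j \<noteq> 0 \<Longrightarrow> j \<noteq> 1 \<Longrightarrow> j \<noteq> k \<Longrightarrow> M $$ (i, j) = 0"
    and rel: "M $$ (i, 0) * int (2 * p) + M $$ (i, 1) * int (2 * q) +
      M $$ (i, k) * int (p * \<alpha> (k - 1) + q * \<beta> (k - 1)) = 0"
    and c: "2 \<le> c" "M $$ (i, i) = - int c"
    and min: "\<And>d. 0 < d \<Longrightarrow> d * a ! i \<in> gen_monoid {a ! j | j. j < n \<and> j \<noteq> i} \<Longrightarrow> c \<le> d"
  shows "principal_row a M i"
proof -
  have "k - 1 \<in> I" using k by auto
  have "(\<Sum>j<n. M $$ (i, j) * int (a ! j)) =
      M $$ (i, 0) * int p + M $$ (i, 1) * int q + M $$ (i, k) * int (h (k - 1))"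
    using sum_three_support[OF k, of "\<lambda>j. M $$ (i, j) * int (a ! j)"] supp a_0 a_1 a_h[OF k] by simp
  moreover have "2 * (M $$ (i, 0) * int p + M $$ (i, 1) * int q + M $$ (i, k) * int (h (k - 1))) = 0"
    using rel unfolding double_h_gen[OF \<open>k - 1 \<in> I\<close>, symmetric] by (simp add: algebra_simps)
  ultimately show ?thesis
    unfolding principal_row_def length_a using off c min by auto
qed

lemma T_entries:
  "j < n \<Longrightarrow> T $$ (0, j) = (if j = 0 then - ((int q + int (\<alpha> (n - 2))) div 2)
     else if j = 1 then (int p - int (\<beta> (n - 2))) div 2 else if j = n - 1 then 1 else 0)"
  "j < n \<Longrightarrow> T $$ (1, j) = (if j = 0 then (int q - int (\<alpha> 1)) div 2
     else if j = 1 then - ((int p + int (\<beta> 1)) div 2) else if j = 2 then 1 else 0)"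
  "2 \<le> i \<Longrightarrow> i < n \<Longrightarrow> j < n \<Longrightarrow> T $$ (i, j) = (if j = 0 then int (\<alpha> (i - 1))
     else if j = 1 then int (\<beta> (i - 1)) else if j = i then - 2 else 0)"
  using n_ge by (simp_all add: T_mat_def)

lemma halves:
  assumes "i \<in> I"
  shows "2 * ((int q + int (\<alpha> i)) div 2) = int q + int (\<alpha> i)"
    "2 * ((int q - int (\<alpha> i)) div 2) = int q - int (\<alpha> i)"
    "2 * ((int p + int (\<beta> i)) div 2) = int p + int (\<beta> i)"
    "2 * ((int p - int (\<beta> i)) div 2) = int p - int (\<beta> i)"
  using hc.parity_\<alpha>[OF assms] hc.parity_\<beta>[OF assms]
  by (auto intro!: dvd_mult_div_cancel)

lemma principal_row_p:
  assumes "\<beta> 1 = 0 \<longrightarrow> q + \<alpha> (n - 2) \<le> 2 * \<alpha> 1"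
  shows "principal_row a T 0"
proof (rule principal_rowI[where k = "n - 1" and c = "(q + \<alpha> (n - 2)) div 2"])
  note e = halves[OF endpoints(2)] and T = T_entries(1)
  have n: "n - 1 - 1 = n - 2" "n - 1 \<noteq> 0" "n - 1 \<noteq> 1" "0 < n" "1 < n" "n - 1 < n" using n_ge by auto
  show "2 \<le> n - 1" "n - 1 < n" using n_ge by auto
  show "0 \<le> T $$ (0, j)" if "j < n" "0 \<noteq> j" for j
    using that T[of j] \<beta>_last by auto
  show "T $$ (0, j) = 0" if "j < n" "j \<noteq> 0" "j \<noteq> 1" "j \<noteq> n - 1" for j
    using that T[of j] by auto
  define x where "x = (int q + int (\<alpha> (n - 2))) div 2"
  define y where "y = (int p - int (\<beta> (n - 2))) div 2"
  have x: "int q = 2 * x - int (\<alpha> (n - 2))" and y: "int p = 2 * y + int (\<beta> (n - 2))"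
    using e unfolding x_def y_def by auto
  have "T $$ (0, 0) = - x" "T $$ (0, 1) = y" "T $$ (0, n - 1) = 1"
    using T[of 0] T[of 1] T[of "n - 1"] n unfolding x_def y_def by auto
  then show "T $$ (0, 0) * int (2 * p) + T $$ (0, 1) * int (2 * q) +
      T $$ (0, n - 1) * int (p * \<alpha> (n - 1 - 1) + q * \<beta> (n - 1 - 1)) = 0"
    unfolding n(1) by (simp add: x y, simp add: algebra_simps)
  show "2 \<le> (q + \<alpha> (n - 2)) div 2" using p_ge p_less_q by linarith
  show "T $$ (0, 0) = - int ((q + \<alpha> (n - 2)) div 2)"
    using T[of 0] n by (simp add: zdiv_int)
  show "(q + \<alpha> (n - 2)) div 2 \<le> d"
    if "0 < d" "d * a ! 0 \<in> gen_monoid {a ! j | j. j < n \<and> j \<noteq> 0}" for d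
    using multiple_of_p[OF that] assms by linarith
qed

lemma principal_row_q:
  assumes "\<alpha> (n - 2) = 0 \<longrightarrow> p + \<beta> 1 \<le> 2 * \<beta> (n - 2)"
  shows "principal_row a T 1"
proof (rule principal_rowI[where k = 2 and c = "(p + \<beta> 1) div 2"])
  note e = halves[OF endpoints(1)] and T = T_entries(2)
  have n: "0 < n" "1 < n" "2 < n" using n_ge by auto
  show "(2::nat) \<le> 2" "2 < n" using n_ge by auto
  show "0 \<le> T $$ (1, j)" if "j < n" "1 \<noteq> j" for j
    using that T[of j] \<alpha>_first by auto
  show "T $$ (1, j) = 0" if "j < n" "j \<noteq> 0" "j \<noteq> 1" "j \<noteq> 2" for j
    using that T[of j] by auto
  define x where "x = (int q - int (\<alpha> 1)) div 2"
  define y where "y = (int p + int (\<beta> 1)) div 2"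
  have x: "int q = 2 * x + int (\<alpha> 1)" and y: "int p = 2 * y - int (\<beta> 1)"
    using e unfolding x_def y_def by auto
  have "T $$ (1, 0) = x" "T $$ (1, 1) = - y" "T $$ (1, 2) = 1"
    using T[of 0] T[of 1] T[of 2] n unfolding x_def y_def by auto
  then show "T $$ (1, 0) * int (2 * p) + T $$ (1, 1) * int (2 * q) +
      T $$ (1, 2) * int (p * \<alpha> (2 - 1) + q * \<beta> (2 - 1)) = 0"
    by (simp add: x y, simp add: algebra_simps)
  \<comment> \<open>The multiplier could drop to 1 only for \<open>p = 3\<close> and \<open>\<beta> 1 = 0\<close>, which parity forbids.\<close>
  have "p = 3 \<Longrightarrow> odd (\<beta> 1)" using hc.parity_\<beta>[OF endpoints(1)] by auto
  then have "p = 3 \<Longrightarrow> \<beta> 1 \<noteq> 0" by (metis even_zero)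
  then show "2 \<le> (p + \<beta> 1) div 2" using p_ge by linarith
  show "T $$ (1, 1) = - int ((p + \<beta> 1) div 2)"
    using T[of 1] n by (simp add: zdiv_int)
  show "(p + \<beta> 1) div 2 \<le> d"
    if "0 < d" "d * a ! 1 \<in> gen_monoid {a ! j | j. j < n \<and> j \<noteq> 1}" for d
    using multiple_of_q[OF that] assms by linarith
qed

lemma principal_row_h:
  assumes i: "2 \<le> i" "i < n" and M: "\<And>j. j < n \<Longrightarrow> M $$ (i, j) = T $$ (i, j)"
  shows "principal_row a M i"
proof (rule principal_rowI[where k = i and c = 2])
  note T = M T_entries(3)[OF i]
  have n: "0 < n" "1 < n" using n_ge by auto
  show "0 \<le> M $$ (i, j)" if "j < n" "i \<noteq> j" for j using that T[of j] by auto
  show "M $$ (i, j) = 0" if "j < n" "j \<noteq> 0" "j \<noteq> 1" "j \<noteq> i" for j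
    using that T[of j] by auto
  show "M $$ (i, 0) * int (2 * p) + M $$ (i, 1) * int (2 * q) +
      M $$ (i, i) * int (p * \<alpha> (i - 1) + q * \<beta> (i - 1)) = 0"
    using T[of 0] T[of 1] T[of i] i by (simp add: algebra_simps)
  show "M $$ (i, i) = - int 2" using T[of i] i by simp
  show "2 \<le> d" if "0 < d" "d * a ! i \<in> gen_monoid {a ! j | j. j < n \<and> j \<noteq> i}" for d
    using multiple_of_h[OF i that] .
qed (use i in auto)

lemma T_carrier: "T \<in> carrier_mat n n"
  by (simp add: T_mat_def)

lemma principal_row_cong:
  assumes "\<And>j. j < length a' \<Longrightarrow> M $$ (i, j) = N $$ (i, j)" and "i < length a'"
  shows "principal_row a' M i \<longleftrightarrow> principal_row a' N i"
  unfolding principal_row_def using assms by simp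

lemma principal_T:
  assumes "T_condition p q n \<alpha> \<beta>"
  shows "principal_matrix (gen_monoid (set a)) a T"
proof (rule principal_matrixI)
  show "principal_row a T i" if "i < length a" for i
  proof -
    consider "i = 0" | "i = 1" | "2 \<le> i" by linarith
    then show ?thesis
    proof cases
      case 1
      with assms principal_row_p show ?thesis unfolding T_condition_iff by simp
    next
      case 2
      with assms principal_row_q show ?thesis unfolding T_condition_iff by simp
    next
      case 3
      with that principal_row_h[of i T] show ?thesis by (simp add: length_a)
    qed
  qed
qed (simp add: length_a T_carrier)

text \<open>Minimality of the generating set prevents a replaced row from having diagonal entry
  \<open>- 1\<close>, which would mean \<open>p = 2 * h 1\<close> or \<open>q = 2 * h (n - 2)\<close>.\<close>

lemma generator_neq_double_h:
  assumes "minimal_generating_set (set a) H" and "x \<in> {p, q}" and "j \<in> I"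
  shows "x \<noteq> 2 * h j"
proof
  assume x: "x = 2 * h j"
  with assms p_ge p_less_q have "h j \<noteq> x" by auto
  then have "h j \<in> gen_monoid (set a - {x})"
    using assms by (intro gen_monoid_base) (auto simp: set_a)
  then have "x \<in> gen_monoid (set a - {x})"
    using x add_in_gen_monoid by (metis mult_2)
  with generator_not_redundant[OF assms(1)] assms(2) show False by (auto simp: set_a)
qed

lemma principal_T_p_even:
  assumes "\<not> T_condition p q n \<alpha> \<beta>" and min: "minimal_generating_set (set a) H" and "even p"
  shows "principal_matrix (gen_monoid (set a)) a (T_mat_p_even p q n \<alpha> \<beta>)"
proof (rule principal_matrixI)
  let ?M = "T_mat_p_even p q n \<alpha> \<beta>"
  have "odd q" using odd_pq \<open>even p\<close> by blast
  then have odd: "odd (\<alpha> 1)" "odd (\<alpha> (n - 2))" using hc.parity_\<alpha> endpoints by auto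
  then have "\<alpha> (n - 2) \<noteq> 0" by (metis even_zero)
  with assms(1) have \<beta>: "\<beta> 1 = 0" and less: "2 * \<alpha> 1 < q + \<alpha> (n - 2)"
    unfolding T_condition_iff by auto
  show "?M \<in> carrier_mat (length a) (length a)"
    using T_carrier by (simp add: length_a T_mat_p_even_def)
  have entries: "?M $$ (i, j) = (if i = 0 then if j = 0 then - int (\<alpha> 1) else if j = 2 then 2 else 0
      else T $$ (i, j))" if "i < n" "j < n" for i j
    using that T_carrier by (auto simp: T_mat_p_even_def)
  have "\<alpha> 1 \<noteq> 1"
    using generator_neq_double_h[OF min, of p 1] double_h_gen[OF endpoints(1)] \<beta> endpoints by auto
  moreover have "\<alpha> 1 \<noteq> 0" using odd by (metis even_zero)
  ultimately have "2 \<le> \<alpha> 1" by linarith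
  have r0: "principal_row a ?M 0"
  proof (rule principal_rowI[where k = 2 and c = "\<alpha> 1"])
    have n: "0 < n" "1 < n" "2 < n" using n_ge by auto
    note M = entries[OF n(1)]
    have "?M $$ (0, 0) = - int (\<alpha> 1)" "?M $$ (0, 1) = 0" "?M $$ (0, 2) = 2"
      using M[of 0] M[of 1] M[of 2] n by auto
    then show "?M $$ (0, 0) = - int (\<alpha> 1)" and
      "?M $$ (0, 0) * int (2 * p) + ?M $$ (0, 1) * int (2 * q) +
        ?M $$ (0, 2) * int (p * \<alpha> (2 - 1) + q * \<beta> (2 - 1)) = 0"
      using \<beta> by simp_all
    show "0 \<le> ?M $$ (0, j)" if "j < n" "0 \<noteq> j" for j using M[of j] that by auto
    show "?M $$ (0, j) = 0" if "j < n" "j \<noteq> 0" "j \<noteq> 1" "j \<noteq> 2" for j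
      using M[of j] that by auto
    show "\<alpha> 1 \<le> d" if "0 < d" "d * a ! 0 \<in> gen_monoid {a ! j | j. j < n \<and> j \<noteq> 0}" for d
      using multiple_of_p[OF that] less by linarith
  qed (use n_ge \<open>2 \<le> \<alpha> 1\<close> in auto)
  have r1: "principal_row a ?M 1"
  proof (subst principal_row_cong)
    show "?M $$ (1, j) = T $$ (1, j)" if "j < length a" for j
      using entries[of 1 j] that n_ge by (simp add: length_a)
    show "1 < length a" using n_ge by (simp add: length_a)
    show "principal_row a T 1" using principal_row_q \<open>\<alpha> (n - 2) \<noteq> 0\<close> by blast
  qed
  have rh: "principal_row a ?M i" if "2 \<le> i" "i < n" for i
  proof (rule principal_row_h[OF that])
    show "?M $$ (i, j) = T $$ (i, j)" if "j < n" for j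
      using entries[of i j] that \<open>2 \<le> i\<close> \<open>i < n\<close> by simp
  qed
  show "principal_row a ?M i" if "i < length a" for i
  proof -
    consider "i = 0" | "i = 1" | "2 \<le> i" by linarith
    then show ?thesis
    proof cases
      case 1
      with r0 show ?thesis by blast
    next
      case 2
      with r1 show ?thesis by blast
    next
      case 3
      with rh that show ?thesis unfolding length_a by blast
    qed
  qed
qed

lemma principal_T_q_even:
  assumes "\<not> T_condition p q n \<alpha> \<beta>" and min: "minimal_generating_set (set a) H" and "even q"
  shows "principal_matrix (gen_monoid (set a)) a (T_mat_q_even p q n \<alpha> \<beta>)"
proof (rule principal_matrixI)
  let ?M = "T_mat_q_even p q n \<alpha> \<beta>"
  have "odd p" using odd_pq \<open>even q\<close> by blast
  then have odd: "odd (\<beta> 1)" "odd (\<beta> (n - 2))" using hc.parity_\<beta> endpoints by auto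
  then have "\<beta> 1 \<noteq> 0" by (metis even_zero)
  with assms(1) have \<alpha>: "\<alpha> (n - 2) = 0" and less: "2 * \<beta> (n - 2) < p + \<beta> 1"
    unfolding T_condition_iff by auto
  show "?M \<in> carrier_mat (length a) (length a)"
    using T_carrier by (simp add: length_a T_mat_q_even_def)
  have entries: "?M $$ (i, j) = (if i = 1 then if j = 1 then - int (\<beta> (n - 2)) else
      if j = n - 1 then 2 else 0 else T $$ (i, j))" if "i < n" "j < n" for i j
    using that T_carrier by (auto simp: T_mat_q_even_def)
  have "\<beta> (n - 2) \<noteq> 1"
    using generator_neq_double_h[OF min, of q "n - 2"] double_h_gen[OF endpoints(2)] \<alpha> endpoints
    by auto
  moreover have "\<beta> (n - 2) \<noteq> 0" using odd by (metis even_zero)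
  ultimately have "2 \<le> \<beta> (n - 2)" by linarith
  have r1: "principal_row a ?M 1"
  proof (rule principal_rowI[where k = "n - 1" and c = "\<beta> (n - 2)"])
    have n: "0 < n" "1 < n" "n - 1 < n" "n - 1 \<noteq> 1" "n - 1 - 1 = n - 2" using n_ge by auto
    note M = entries[OF n(2)]
    have "?M $$ (1, 0) = 0" "?M $$ (1, 1) = - int (\<beta> (n - 2))" "?M $$ (1, n - 1) = 2"
      using M[of 0] M[of 1] M[of "n - 1"] n by auto
    then show "?M $$ (1, 1) = - int (\<beta> (n - 2))" and
      "?M $$ (1, 0) * int (2 * p) + ?M $$ (1, 1) * int (2 * q) +
        ?M $$ (1, n - 1) * int (p * \<alpha> (n - 1 - 1) + q * \<beta> (n - 1 - 1)) = 0"
      unfolding n(5) using \<alpha> by simp_all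
    show "0 \<le> ?M $$ (1, j)" if "j < n" "1 \<noteq> j" for j using M[of j] that by auto
    show "?M $$ (1, j) = 0" if "j < n" "j \<noteq> 0" "j \<noteq> 1" "j \<noteq> n - 1" for j
      using M[of j] that by auto
    show "\<beta> (n - 2) \<le> d"
      if "0 < d" "d * a ! 1 \<in> gen_monoid {a ! j | j. j < n \<and> j \<noteq> 1}" for d
      using multiple_of_q[OF that] less by linarith
  qed (use n_ge \<open>2 \<le> \<beta> (n - 2)\<close> in auto)
  have r0: "principal_row a ?M 0"
  proof (subst principal_row_cong)
    show "?M $$ (0, j) = T $$ (0, j)" if "j < length a" for j
      using entries[of 0 j] that n_ge by (simp add: length_a)
    show "0 < length a" using n_ge by (simp add: length_a)
    show "principal_row a T 0" using principal_row_p \<open>\<beta> 1 \<noteq> 0\<close> by blast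
  qed
  have rh: "principal_row a ?M i" if "2 \<le> i" "i < n" for i
  proof (rule principal_row_h[OF that])
    show "?M $$ (i, j) = T $$ (i, j)" if "j < n" for j
      using entries[of i j] that \<open>2 \<le> i\<close> \<open>i < n\<close> by simp
  qed
  show "principal_row a ?M i" if "i < length a" for i
  proof -
    consider "i = 0" | "i = 1" | "2 \<le> i" by linarith
    then show ?thesis
    proof cases
      case 1
      with r0 show ?thesis by blast
    next
      case 2
      with r1 show ?thesis by blast
    next
      case 3
      with rh that show ?thesis unfolding length_a by blast
    qed
  qed
qed

text \<open>If \<open>p\<close> is even, \<open>\<beta> i\<close> is even and \<open>h i\<close> is \<open>\<alpha> i\<close> times \<open>p div 2\<close> plus a multiple of \<open>q\<close>;
  the case of even \<open>q\<close> is analogous. If both are odd, so are \<open>\<alpha> i\<close> and \<open>\<beta> i\<close>, and one copy of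
  \<open>(p + q) div 2\<close> absorbs the two halves.\<close>

lemma h_in_KW_bound:
  assumes "i \<in> I"
  shows "h i \<in> gen_monoid {p, q, KW_gen p q}"
proof -
  let ?r = "KW_gen p q"
  have comb: "x * p + y * q + z * ?r \<in> gen_monoid {p, q, ?r}" for x y z
    by (intro add_in_gen_monoid mult_in_gen_monoid gen_monoid_base) auto
  have \<alpha>\<beta>: "even (\<alpha> i) \<longleftrightarrow> even q" "even (\<beta> i) \<longleftrightarrow> even p" and h: "2 * h i = p * \<alpha> i + q * \<beta> i"
    using assms hc.parity_\<alpha> hc.parity_\<beta> double_h_gen by auto
  consider "even p" "odd q" | "even q" "odd p" | "odd p" "odd q" using odd_pq by blast
  then have "\<exists>x y z. h i = x * p + y * q + z * ?r"
  proof cases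
    case 1
    then obtain s b where "p = 2 * s" "\<beta> i = 2 * b" using \<alpha>\<beta> by (metis evenE)
    then have "h i = 0 * p + b * q + \<alpha> i * ?r" using h 1 by (simp add: KW_gen_def algebra_simps)
    then show ?thesis by blast
  next
    case 2
    then obtain s b where "q = 2 * s" "\<alpha> i = 2 * b" using \<alpha>\<beta> by (metis evenE)
    then have "h i = b * p + 0 * q + \<beta> i * ?r" using h 2 by (simp add: KW_gen_def algebra_simps)
    then show ?thesis by blast
  next
    case 3
    then obtain s b where sb: "\<alpha> i = 2 * s + 1" "\<beta> i = 2 * b + 1" using \<alpha>\<beta> by (metis oddE)
    have "2 * ?r = p + q" using 3 by (simp add: KW_gen_def)
    then have "2 * h i = 2 * (s * p + b * q + 1 * ?r)" using h sb by (simp add: algebra_simps)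
    then show ?thesis by (metis mult_left_cancel zero_neq_numeral)
  qed
  with comb show ?thesis by auto
qed

lemma gen_in_KW: "gen_monoid (set a) \<in> KW p q"
proof -
  have "Gcd (set a) dvd gcd p q"
    by (intro gcd_greatest Gcd_dvd) (auto simp: set_a)
  then have "Gcd (set a) = 1" using cop by simp
  then have "numerical_semigroup (gen_monoid (set a))"
    unfolding numerical_semigroup_def by blast
  moreover have "gen_monoid {p, q} \<subseteq> gen_monoid (set a)"
    by (rule gen_monoid_mono) (auto simp: set_a)
  moreover have "gen_monoid (set a) \<subseteq> gen_monoid {p, q, KW_gen p q}"
    by (rule gen_monoid_least[OF _ add_submonoid_gen_monoid])
      (use h_in_KW_bound in \<open>auto simp: set_a intro: gen_monoid_base\<close>)
  ultimately show ?thesis unfolding KW_def by blast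
qed

end

theorem theorem3p1:
  fixes p q n :: nat and \<alpha> \<beta> :: "nat \<Rightarrow> nat" and H :: "nat set"
  assumes "3 \<le> p" and "p < q" and "coprime p q" and "3 \<le> n"
    and "\<forall>i\<in>{1..n - 2}. even (\<alpha> i) \<longleftrightarrow> even q"
    and "\<alpha> 1 < q" and "\<forall>i\<in>{1..<n - 2}. \<alpha> (i + 1) < \<alpha> i"
    and "\<forall>i\<in>{1..n - 2}. even (\<beta> i) \<longleftrightarrow> even p"
    and "\<forall>i\<in>{1..<n - 2}. \<beta> i < \<beta> (i + 1)" and "\<beta> (n - 2) < p"
    and "H = gen_monoid (set (gens p q n \<alpha> \<beta>))"
  shows "(T_condition p q n \<alpha> \<beta> \<longrightarrow>
           (principal_matrix H (gens p q n \<alpha> \<beta>) (T_mat p q n \<alpha> \<beta>) \<longleftrightarrow> H \<in> KW p q)) \<and>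
         (\<not> T_condition p q n \<alpha> \<beta> \<and> minimal_generating_set (set (gens p q n \<alpha> \<beta>)) H \<longrightarrow>
           (even p \<longrightarrow> principal_matrix H (gens p q n \<alpha> \<beta>) (T_mat_p_even p q n \<alpha> \<beta>)) \<and>
           (even q \<longrightarrow> principal_matrix H (gens p q n \<alpha> \<beta>) (T_mat_q_even p q n \<alpha> \<beta>)))"
proof -
  interpret kw_sequences p q n \<alpha> \<beta>
    using assms by unfold_locales auto
  show ?thesis
    using principal_T gen_in_KW principal_T_p_even principal_T_q_even assms(11) by blast
qed

end
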